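(* Let $K = I\times J$ be a cubulated 2D rectangle, where $I=[a,d]$ with $d-a\ge 4$, and let $b$, $c$ be integers with $a<b<c<d$. Let $U=[a,c]\times J$ and $W=[b,d]\times J$, so that $K=U\cup W$. Let $\alpha$ be the algorithm ProcessLowerStars, applied with a fixed grayscale function on the vertices of $K$ that takes pairwise distinct values (and its restrictions to the vertices of subcomplexes). Then $$V_{\alpha}(K) = \bigl(V_{\alpha}(U)\cup V_{\alpha}(W)\bigr) \setminus \Bigl( V_{\alpha}(U\cap W) \setminus V_{\alpha}\bigl((U\cap W)[1]\bigr)\Bigr).$$
   Context: Here $I$ and $J$ are intervals of positive length with integer endpoints, and the rectangle $I\times J$ carries the standard cubical structure: vertices are the integer points, edges are the unit segments between neighboring integer points, and 2-cells are the unit squares. Cells are closed when we speak of the vertices they contain. Neighborhoods. Two cells of $K$ are adjacent if their closures have a point in common. The star of a cell is the smallest subcomplex of $K$ containing all cells adjacent to it, and for a subcomplex $L$ of $K$, $L[1]$ is the smallest subcomplex of $K$ containing the stars of all cells of $L$. The algorithm ProcessLowerStars. Input: a finite cubical complex $C$ (here a subcomplex of $K$) and a positive bounded function $g$ on its vertices with pairwise distinct values. Output: a list $V_{\alpha}(C)$ of pairs $(\sigma\le\tau)$, where $\sigma$ is a codimension $1$ face of $\tau$, and a list of critical cells. For a vertex $x$ of $C$, the lower star $L(x)$ is the set of cells $\sigma$ of $C$ with $g(x)=\max_{y\in\sigma} g(y)$, the maximum being over the vertices of $\sigma$ (so $x\in\sigma$). For a cell $\sigma$, let $G(\sigma)$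 be the sequence of $g$-values of its vertices listed in decreasing order; cells are ordered by lexicographic order on $G$. For each vertex $x$ independently, the cells of $L(x)$ are processed as follows, using two priority queues PQzero and PQone ordered by $G$, both initially empty. Faces and cofaces are of codimension $1$ and within $L(x)$, and a cell is called unpaired if it has not yet been put into a pair of $V$ or into the critical list. 1. If $L(x)=\{x\}$, then $x$ is critical. Otherwise let $\tau$ be the $G$-minimal 1-cell of $L(x)$; put $(x\le\tau)$ in $V$; put all other 1-cells of $L(x)$ in PQzero; put in PQone all cofaces of $\tau$ in $L(x)$ that have exactly one unpaired face in $L(x)$. 2. While PQone or PQzero is nonempty: (a) while PQone is nonempty, remove its $G$-minimal cell $\beta$; if $\beta$ has no unpaired face in $L(x)$, put $\beta$ in PQzero; otherwise put the pair ($\sigma\le\beta$) in $V$, where $\sigma$ is its unpaired face in $L(x)$, remove $\sigma$ from PQzero, and put in PQone all cofaces of $\sigma$ or of $\beta$ in $L(x)$ having exactly one unpaired face in $L(x)$; (b) then, if PQzero is nonempty, remove its $G$-minimal cell $\delta$, declare $\delta$ critical, and put in PQone all cofaces of $\delta$ in $L(x)$ having exactly one unpaired face in $L(x)$. $V_{\alpha}(C)$ is the set of all pairs obtained over all vertices $x$ of $C$. When $\alpha$ is applied to a subcomplex $C$ of $K$, lower stars are taken in $C$ and $g$ is restricted to the vertices of $C$. *)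

theory Defs
  imports Complex_Main "HOL-Library.List_Lexorder" "HOL-Library.While_Combinator"
begin

section \<open>Cubical complexes in the plane\<close>

text \<open>\<open>Pt i\<close> stands for the degenerate interval $\{i\}$ and \<open>Seg i\<close> for $[i, i+1]$. A cell of the
  standard cubical structure on the plane is a product of two such intervals; a complex is
  represented by its set of cells.\<close>

datatype elem_interval = Pt int | Seg int

type_synonym cell = "elem_interval \<times> elem_interval"
type_synonym vertex = "int \<times> int"

fun closed_interval :: "elem_interval \<Rightarrow> real set" where
  "closed_interval (Pt i) = {real_of_int i}"
| "closed_interval (Seg i) = {real_of_int i .. real_of_int i + 1}"

fun dim_interval :: "elem_interval \<Rightarrow> nat" where
  "dim_interval (Pt i) = 0"
| "dim_interval (Seg i) = 1"

definition closed_cell :: "cell \<Rightarrow> (real \<times> real) set" where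
  "closed_cell \<sigma> = closed_interval (fst \<sigma>) \<times> closed_interval (snd \<sigma>)"

definition cell_dim :: "cell \<Rightarrow> nat" where
  "cell_dim \<sigma> = dim_interval (fst \<sigma>) + dim_interval (snd \<sigma>)"

definition cell_vertices :: "cell \<Rightarrow> vertex set" where
  "cell_vertices \<sigma> = {(i, j). (real_of_int i, real_of_int j) \<in> closed_cell \<sigma>}"

definition vertex_cell :: "vertex \<Rightarrow> cell" where
  "vertex_cell x = (Pt (fst x), Pt (snd x))"

definition face :: "cell \<Rightarrow> cell \<Rightarrow> bool" where
  "face \<sigma> \<tau> \<longleftrightarrow> closed_cell \<sigma> \<subseteq> closed_cell \<tau>"

definition codim1_face :: "cell \<Rightarrow> cell \<Rightarrow> bool" where
  "codim1_face \<sigma> \<tau> \<longleftrightarrow> face \<sigma> \<tau> \<and> cell_dim \<tau> = cell_dim \<sigma> + 1"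

definition complex_vertices :: "cell set \<Rightarrow> vertex set" where
  "complex_vertices C = {x. vertex_cell x \<in> C}"

text \<open>The cubulated rectangle $[a,d] \times [e,f]$.\<close>

definition rectangle :: "int \<Rightarrow> int \<Rightarrow> int \<Rightarrow> int \<Rightarrow> cell set" where
  "rectangle a d e f =
     {\<sigma>. closed_cell \<sigma> \<subseteq> {real_of_int a .. real_of_int d} \<times> {real_of_int e .. real_of_int f}}"

definition subcomplex :: "cell set \<Rightarrow> cell set \<Rightarrow> bool" where
  "subcomplex K M \<longleftrightarrow> M \<subseteq> K \<and> (\<forall>\<tau>\<in>M. \<forall>\<sigma>. face \<sigma> \<tau> \<longrightarrow> \<sigma> \<in> M)"

definition adjacent :: "cell \<Rightarrow> cell \<Rightarrow> bool" where
  "adjacent \<sigma> \<tau> \<longleftrightarrow> closed_cell \<sigma> \<inter> closed_cell \<tau> \<noteq> {}"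

definition star :: "cell set \<Rightarrow> cell \<Rightarrow> cell set" where
  "star K \<sigma> = subcomplex K hull {\<tau> \<in> K. adjacent \<sigma> \<tau>}"

text \<open>\<open>nbhd1 K L\<close> is $L[1]$, taken inside the ambient complex \<open>K\<close>.\<close>

definition nbhd1 :: "cell set \<Rightarrow> cell set \<Rightarrow> cell set" where
  "nbhd1 K L = subcomplex K hull (\<Union>\<sigma>\<in>L. star K \<sigma>)"


section \<open>The algorithm ProcessLowerStars\<close>

text \<open>For \<open>g\<close> injective on the vertices of \<open>C\<close> and \<open>x\<close> a vertex of \<open>C\<close>, membership in the lower
  star forces \<open>x \<in> cell_vertices \<sigma>\<close>.\<close>

definition lower_star :: "(vertex \<Rightarrow> real) \<Rightarrow> cell set \<Rightarrow> vertex \<Rightarrow> cell set" where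
  "lower_star g C x = {\<sigma> \<in> C. g x = Max (g ` cell_vertices \<sigma>)}"

text \<open>Decreasing sequence of the vertex values (which are pairwise distinct, so passing to the set
  of values loses nothing). Lists are compared by the lexicographic order of
  \<open>HOL-Library.List_Lexorder\<close>, in which a proper prefix is smaller.\<close>

definition G_seq :: "(vertex \<Rightarrow> real) \<Rightarrow> cell \<Rightarrow> real list" where
  "G_seq g \<sigma> = rev (sorted_list_of_set (g ` cell_vertices \<sigma>))"

definition G_minimal :: "(vertex \<Rightarrow> real) \<Rightarrow> cell set \<Rightarrow> cell" where
  "G_minimal g S = arg_min_on (G_seq g) S"

text \<open>A priority queue is represented by the set of cells it contains; its order is that of
  \<^const>\<open>G_seq\<close>. The lists of pairs and of critical cells are represented by sets as well.\<close>

record pls_state =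
  pairs :: "(cell \<times> cell) set"
  critical :: "cell set"
  PQzero :: "cell set"
  PQone :: "cell set"

definition unpaired :: "pls_state \<Rightarrow> cell \<Rightarrow> bool" where
  "unpaired s \<sigma> \<longleftrightarrow> \<sigma> \<notin> fst ` pairs s \<and> \<sigma> \<notin> snd ` pairs s \<and> \<sigma> \<notin> critical s"

text \<open>In the following, \<open>L\<close> is the lower star being processed.\<close>

definition unpaired_faces :: "cell set \<Rightarrow> pls_state \<Rightarrow> cell \<Rightarrow> cell set" where
  "unpaired_faces L s \<beta> = {\<sigma> \<in> L. codim1_face \<sigma> \<beta> \<and> unpaired s \<sigma>}"

definition enqueue_cofaces :: "cell set \<Rightarrow> cell set \<Rightarrow> pls_state \<Rightarrow> pls_state" where
  "enqueue_cofaces L S s =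
     s\<lparr>PQone := PQone s \<union>
        {\<gamma> \<in> L. (\<exists>\<sigma>\<in>S. codim1_face \<sigma> \<gamma>) \<and> card (unpaired_faces L s \<gamma>) = 1}\<rparr>"

definition pls_init :: "(vertex \<Rightarrow> real) \<Rightarrow> cell set \<Rightarrow> vertex \<Rightarrow> pls_state" where
  "pls_init g L x =
     (if L = {vertex_cell x}
      then \<lparr>pairs = {}, critical = {vertex_cell x}, PQzero = {}, PQone = {}\<rparr>
      else let \<tau> = G_minimal g {\<sigma> \<in> L. cell_dim \<sigma> = 1} in
        enqueue_cofaces L {\<tau>}
          \<lparr>pairs = {(vertex_cell x, \<tau>)}, critical = {},
           PQzero = {\<sigma> \<in> L. cell_dim \<sigma> = 1} - {\<tau>}, PQone = {}\<rparr>)"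

text \<open>A cell in \<open>PQone\<close> has had at most one unpaired face since it was inserted, so
  \<^const>\<open>the_elem\<close> below is applied to a singleton.\<close>

definition pls_step_one :: "(vertex \<Rightarrow> real) \<Rightarrow> cell set \<Rightarrow> pls_state \<Rightarrow> pls_state" where
  "pls_step_one g L s =
     (let \<beta> = G_minimal g (PQone s); s' = s\<lparr>PQone := PQone s - {\<beta>}\<rparr> in
      if unpaired_faces L s' \<beta> = {} then s'\<lparr>PQzero := PQzero s' \<union> {\<beta>}\<rparr>
      else let \<sigma> = the_elem (unpaired_faces L s' \<beta>) in
        enqueue_cofaces L {\<sigma>, \<beta>}
          (s'\<lparr>pairs := pairs s' \<union> {(\<sigma>, \<beta>)}, PQzero := PQzero s' - {\<sigma>}\<rparr>))"

definition pls_step_zero :: "(vertex \<Rightarrow> real) \<Rightarrow> cell set \<Rightarrow> pls_state \<Rightarrow> pls_state" where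
  "pls_step_zero g L s =
     (if PQzero s = {} then s
      else let \<delta> = G_minimal g (PQzero s) in
        enqueue_cofaces L {\<delta>}
          (s\<lparr>PQzero := PQzero s - {\<delta>}, critical := critical s \<union> {\<delta>}\<rparr>))"

definition process_lower_star :: "(vertex \<Rightarrow> real) \<Rightarrow> cell set \<Rightarrow> vertex \<Rightarrow> pls_state" where
  "process_lower_star g C x =
     (let L = lower_star g C x in
      while (\<lambda>s. PQone s \<noteq> {} \<or> PQzero s \<noteq> {})
        (\<lambda>s. pls_step_zero g L (while (\<lambda>s. PQone s \<noteq> {}) (pls_step_one g L) s))
        (pls_init g L x))"

definition V_alpha :: "(vertex \<Rightarrow> real) \<Rightarrow> cell set \<Rightarrow> (cell \<times> cell) set" where
  "V_alpha g C = (\<Union>x\<in>complex_vertices C. pairs (process_lower_star g C x))"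

end

theory Submission
  imports Defs
begin

text \<open>The identity is a statement about locality: what the algorithm does at a vertex \<open>x\<close> depends only
  on the lower star of \<open>x\<close>, and that lower star consists of cells containing \<open>x\<close>, so cutting the
  rectangle along a vertical line changes it only for \<open>x\<close> on that line
  (\<open>lower_star_rectangle_eq\<close>). Hence \<open>U\<close> produces the same pairs as \<open>K\<close> at every vertex to the left
  of the line \<open>c\<close>, and \<open>W\<close> the same pairs at every vertex to the right of the line \<open>b\<close>; since \<open>b < c\<close>,
  every vertex is of one of these kinds, and all pairs of \<open>K\<close> occur in \<open>U\<close> or \<open>W\<close>. The only possible
  excess comes from the vertices of \<open>U\<close> on the line \<open>c\<close> and those of \<open>W\<close> on the line \<open>b\<close>. There \<open>U\<close>,
  respectively \<open>W\<close>, has the same lower star as the strip \<open>U \<inter> W\<close>. One step of enlargement turns the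
  strip into \<open>[b-1,c+1] \<times> J\<close> (\<open>nbhd1_strip\<close>), which has the same lower stars as \<open>K\<close> at every vertex of
  the strip. So removing the pairs of the strip that its enlargement does not have removes
  exactly the excess.

  This argument compares sets of pairs vertex by vertex, so a pair must determine the vertex at
  which it was produced. It does: its first component lies in the lower star of that vertex, and the
  largest value of \<open>g\<close> on a cell belongs to just one vertex (\<open>fst_pair_in_lower_star\<close>,
  \<open>lower_star_vertex_unique\<close>). To know that pairs stay in the lower star one has to run the algorithm,
  and a loop yields a known value only if it terminates. The number of cells not yet classified
  drops with every pass of the outer loop; the reason is an invariant saying that a cell
  with an unpaired face is itself unpaired, and that whatever waits in a queue is unpaired, so that no
  cell is ever classified twice (\<open>pls_invariant\<close>, \<open>pairs_process_lower_star\<close>).\<close>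

section \<open>Cells of a rectangle\<close>

lemma closed_interval_nonempty: "closed_interval s \<noteq> {}"
  by (cases s) auto

lemma closed_interval_subset_iff:
  "closed_interval s \<subseteq> {real_of_int a .. real_of_int d} \<longleftrightarrow>
     (case s of Pt i \<Rightarrow> a \<le> i \<and> i \<le> d | Seg i \<Rightarrow> a \<le> i \<and> i + 1 \<le> d)"
proof (cases s)
  case (Seg i)
  have "real_of_int i + 1 \<le> real_of_int d \<longleftrightarrow> i + 1 \<le> d"
    by linarith
  then show ?thesis using Seg by simp
qed auto

lemma mem_rectangle_iff:
  "(s, t) \<in> rectangle a d e f \<longleftrightarrow>
     closed_interval s \<subseteq> {real_of_int a .. real_of_int d} \<and>
     closed_interval t \<subseteq> {real_of_int e .. real_of_int f}"
  using closed_interval_nonempty[of s] closed_interval_nonempty[of t]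
  unfolding rectangle_def closed_cell_def by (auto simp: times_subset_iff)

lemma face_iff:
  "face (s, t) (s', t') \<longleftrightarrow> closed_interval s \<subseteq> closed_interval s' \<and> closed_interval t \<subseteq> closed_interval t'"
  using closed_interval_nonempty[of s] closed_interval_nonempty[of t]
  unfolding face_def closed_cell_def by (auto simp: times_subset_iff)

lemma adjacent_iff:
  "adjacent (s, t) (s', t') \<longleftrightarrow>
     closed_interval s \<inter> closed_interval s' \<noteq> {} \<and> closed_interval t \<inter> closed_interval t' \<noteq> {}"
  unfolding adjacent_def closed_cell_def by (auto simp: Times_Int_Times)

lemma rectangle_Int:
  "rectangle a c e f \<inter> rectangle b d e f = rectangle (max a b) (min c d) e f"
  by (auto simp: mem_rectangle_iff closed_interval_subset_iff split: elem_interval.splits)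

lemma rectangle_mono:
  "a \<le> a' \<Longrightarrow> d' \<le> d \<Longrightarrow> rectangle a' d' e f \<subseteq> rectangle a d e f"
  by (auto simp: mem_rectangle_iff closed_interval_subset_iff split: elem_interval.splits)

lemma complex_vertices_rectangle:
  "complex_vertices (rectangle a d e f) = {a..d} \<times> {e..f}"
  by (auto simp: complex_vertices_def vertex_cell_def mem_rectangle_iff)

lemma finite_rectangle: "finite (rectangle a d e f)"
proof (rule finite_subset)
  let ?I = "Pt ` {a..d} \<union> Seg ` {a..d}" and ?J = "Pt ` {e..f} \<union> Seg ` {e..f}"
  show "rectangle a d e f \<subseteq> ?I \<times> ?J"
    by (auto simp: mem_rectangle_iff closed_interval_subset_iff split: elem_interval.splits)
qed auto

lemma subcomplex_rectangle:
  "rectangle a' d' e f \<subseteq> rectangle a d e f \<Longrightarrow>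
     subcomplex (rectangle a d e f) (rectangle a' d' e f)"
  unfolding subcomplex_def face_def rectangle_def by blast

text \<open>A cell touching the strip lies in it or in one of the two adjacent unit-wide columns; conversely
  those columns are filled by closures of cells touching the strip, and \<open>a < b\<close>, \<open>c < d\<close> leave
  room for them in the ambient rectangle.\<close>

lemma nbhd1_strip:
  assumes "a < b" "b \<le> c" "c < d"
  shows "nbhd1 (rectangle a d e f) (rectangle b c e f) = rectangle (b - 1) (c + 1) e f"
proof
  let ?K = "rectangle a d e f" and ?L = "rectangle b c e f" and ?N = "rectangle (b - 1) (c + 1) e f"
  have sub: "subcomplex ?K ?N"
    using assms by (intro subcomplex_rectangle rectangle_mono) auto
  have "star ?K \<sigma> \<subseteq> ?N" if "\<sigma> \<in> ?L" for \<sigma>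
    unfolding star_def
  proof (rule hull_minimal[where S = "subcomplex ?K", OF _ sub], safe)
    fix s' t' assume K: "(s', t') \<in> ?K" and adj: "adjacent \<sigma> (s', t')"
    obtain s t where \<sigma>: "\<sigma> = (s, t)" by fastforce
    obtain z where z: "z \<in> closed_interval s" "z \<in> closed_interval s'"
      using adj unfolding \<sigma> adjacent_iff by blast
    then have "real_of_int b \<le> z" "z \<le> real_of_int c"
      using that unfolding \<sigma> mem_rectangle_iff by auto
    then show "(s', t') \<in> ?N"
      using z(2) K unfolding mem_rectangle_iff closed_interval_subset_iff
      by (cases s') auto
  qed
  then show "nbhd1 ?K ?L \<subseteq> ?N"
    unfolding nbhd1_def by (intro hull_minimal[where S = "subcomplex ?K", OF _ sub]) auto
  show "?N \<subseteq> nbhd1 ?K ?L"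
  proof
    fix \<tau> assume \<tau>N: "\<tau> \<in> ?N"
    obtain s t where \<tau>: "\<tau> = (s, t)" by fastforce
    have t: "closed_interval t \<subseteq> {real_of_int e .. real_of_int f}"
      using \<tau>N unfolding \<tau> mem_rectangle_iff by auto
    \<comment> \<open>A vertical line just outside the strip touches no cell of the strip, but it is a face of
      a cell of the neighbouring unit-wide column, which does.\<close>
    obtain m s' where m: "b \<le> m" "m \<le> c" "real_of_int m \<in> closed_interval s'"
      and s': "closed_interval s' \<subseteq> {real_of_int a .. real_of_int d}"
      and ss': "closed_interval s \<subseteq> closed_interval s'"
    proof (cases s)
      case (Pt i)
      then have i: "b - 1 \<le> i" "i \<le> c + 1"
        using \<tau>N by (auto simp: \<tau> mem_rectangle_iff)
      consider "i = b - 1" | "i = c + 1" | "b \<le> i" "i \<le> c" using i by linarith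
      then show thesis
      proof cases
        case 1 then show thesis using that[of b "Seg (b - 1)"] assms Pt by auto
      next
        case 2 then show thesis using that[of c "Seg c"] assms Pt by auto
      next
        case 3 then show thesis using that[of i s] assms Pt by auto
      qed
    next
      case (Seg i)
      then have i: "b - 1 \<le> i" "i + 1 \<le> c + 1"
        using \<tau>N by (auto simp: \<tau> mem_rectangle_iff closed_interval_subset_iff)
      show thesis
        using that[of "max i b" s] assms i Seg
        by (auto simp: closed_interval_subset_iff simp del: closed_interval.simps)
           (auto simp: max_def)
    qed
    have "(Pt m, t) \<in> ?L"
      using m t by (auto simp: mem_rectangle_iff)
    moreover have "(s', t) \<in> star ?K (Pt m, t)"
      unfolding star_def using m(3) s' t closed_interval_nonempty[of t]
      by (intro hull_inc) (auto simp: adjacent_iff mem_rectangle_iff)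
    ultimately have s't: "(s', t) \<in> (\<Union>\<sigma>\<in>?L. star ?K \<sigma>)" by blast
    have face: "face \<tau> (s', t)"
      using ss' by (simp add: \<tau> face_iff)
    show "\<tau> \<in> nbhd1 ?K ?L"
      unfolding nbhd1_def hull_def using s't face unfolding subcomplex_def by blast
  qed
qed


section \<open>Locality of lower stars\<close>

lemma cell_vertices_alt:
  "cell_vertices (s, t) =
     {i. real_of_int i \<in> closed_interval s} \<times> {j. real_of_int j \<in> closed_interval t}"
  by (auto simp: cell_vertices_def closed_cell_def)

lemma integer_points_Seg: "{j. real_of_int j \<in> closed_interval (Seg i)} = {i, i + 1}"
  by auto

lemma finite_cell_vertices: "finite (cell_vertices \<sigma>)"
proof -
  have "finite {i. real_of_int i \<in> closed_interval s}" for s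
    by (cases s) (auto simp: integer_points_Seg simp del: closed_interval.simps(2))
  then show ?thesis by (cases \<sigma>) (simp add: cell_vertices_alt)
qed

lemma cell_vertices_nonempty: "cell_vertices \<sigma> \<noteq> {}"
proof -
  have "{i. real_of_int i \<in> closed_interval s} \<noteq> {}" for s
    by (cases s) (auto simp: integer_points_Seg simp del: closed_interval.simps(2))
  then show ?thesis by (cases \<sigma>) (simp add: cell_vertices_alt)
qed

lemma cell_vertices_vertex_cell: "cell_vertices (vertex_cell x) = {x}"
  by (cases x) (auto simp: cell_vertices_alt vertex_cell_def)

lemma cell_vertices_rectangle:
  "\<sigma> \<in> rectangle a d e f \<Longrightarrow> cell_vertices \<sigma> \<subseteq> complex_vertices (rectangle a d e f)"
  by (cases \<sigma>) (fastforce simp: cell_vertices_alt mem_rectangle_iff complex_vertices_rectangle)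

lemma lower_star_contains_vertex:
  assumes "inj_on g X" "cell_vertices \<sigma> \<subseteq> X" "x \<in> X" "\<sigma> \<in> lower_star g C x"
  shows "x \<in> cell_vertices \<sigma>"
proof -
  have "g x \<in> g ` cell_vertices \<sigma>"
    using assms(4) finite_cell_vertices[of \<sigma>] cell_vertices_nonempty[of \<sigma>]
    by (simp add: lower_star_def)
  then show ?thesis
    using assms(1-3) by (auto dest: inj_onD)
qed

text \<open>A cell containing \<open>x\<close> reaches at most one unit beyond \<open>x\<close>, so it can leave the smaller rectangle
  only across a side that is new and contains \<open>x\<close>; the last two hypotheses exclude such sides.\<close>

lemma lower_star_rectangle_eq:
  assumes inj: "inj_on g (complex_vertices (rectangle a d e f))"
    and "a \<le> a'" "d' \<le> d"
    and x: "x \<in> complex_vertices (rectangle a' d' e f)"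
    and left: "a' = a \<or> a' < fst x" and right: "d' = d \<or> fst x < d'"
  shows "lower_star g (rectangle a' d' e f) x = lower_star g (rectangle a d e f) x"
proof
  show "lower_star g (rectangle a' d' e f) x \<subseteq> lower_star g (rectangle a d e f) x"
    using rectangle_mono[OF \<open>a \<le> a'\<close> \<open>d' \<le> d\<close>] by (auto simp: lower_star_def)
next
  have xK: "x \<in> complex_vertices (rectangle a d e f)"
    using x assms(2,3) by (auto simp: complex_vertices_rectangle)
  show "lower_star g (rectangle a d e f) x \<subseteq> lower_star g (rectangle a' d' e f) x"
  proof
    fix \<sigma> assume \<sigma>: "\<sigma> \<in> lower_star g (rectangle a d e f) x"
    then have \<sigma>K: "\<sigma> \<in> rectangle a d e f"
      by (simp add: lower_star_def)
    have "x \<in> cell_vertices \<sigma>"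
      by (rule lower_star_contains_vertex[OF inj cell_vertices_rectangle[OF \<sigma>K] xK \<sigma>])
    then have "\<sigma> \<in> rectangle a' d' e f"
      using \<sigma>K left right
      by (cases \<sigma>; cases x; cases "fst \<sigma>")
         (auto simp: cell_vertices_alt mem_rectangle_iff closed_interval_subset_iff)
    then show "\<sigma> \<in> lower_star g (rectangle a' d' e f) x"
      using \<sigma> by (simp add: lower_star_def)
  qed
qed


section \<open>The algorithm terminates\<close>

definition unpaired_cells :: "cell set \<Rightarrow> pls_state \<Rightarrow> cell set" where
  "unpaired_cells L s = {\<sigma> \<in> L. unpaired s \<sigma>}"

text \<open>When a cell is paired or critical, so are all its faces in the lower star: this is the
  fifth conjunct, and it keeps classified cells from entering \<open>PQone\<close> again. The vertex is classified at
  the start, so an unpaired face is always an edge; hence \<open>PQone\<close> holds only squares, and the edges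
  in \<open>PQzero\<close> have no unpaired face, like the squares that are moved there. The bound on the
  unpaired faces of squares in \<open>PQone\<close> makes the choice of the partner meaningful.\<close>

definition pls_invariant :: "cell set \<Rightarrow> pls_state \<Rightarrow> bool" where
  "pls_invariant L s \<longleftrightarrow>
     fst ` pairs s \<subseteq> L \<and> PQzero s \<subseteq> L \<and> PQone s \<subseteq> L \<and>
     (\<forall>\<sigma>\<in>L. unpaired s \<sigma> \<longrightarrow> cell_dim \<sigma> \<noteq> 0) \<and>
     (\<forall>\<sigma>\<in>L. unpaired_faces L s \<sigma> \<noteq> {} \<longrightarrow> unpaired s \<sigma>) \<and>
     (\<forall>\<sigma>\<in>PQzero s. unpaired s \<sigma> \<and> unpaired_faces L s \<sigma> = {}) \<and>
     (\<forall>\<beta>\<in>PQone s. unpaired s \<beta> \<and> cell_dim \<beta> = 2 \<and> (\<exists>\<sigma>. unpaired_faces L s \<beta> \<subseteq> {\<sigma>}))"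

lemma cell_dim_le_2: "cell_dim \<sigma> \<le> 2"
proof -
  have "dim_interval s \<le> 1" for s by (cases s) auto
  from this[of "fst \<sigma>"] this[of "snd \<sigma>"] show ?thesis by (simp add: cell_dim_def)
qed

lemma codim1_face_dim: "codim1_face \<sigma> \<tau> \<Longrightarrow> cell_dim \<tau> = cell_dim \<sigma> + 1"
  by (simp add: codim1_face_def)

lemma unpaired_faces_dim_2:
  assumes "pls_invariant L s" "\<sigma> \<in> unpaired_faces L s \<beta>"
  shows "cell_dim \<sigma> = 1" "cell_dim \<beta> = 2"
  using assms codim1_face_dim[of \<sigma> \<beta>] cell_dim_le_2[of \<beta>]
  by (fastforce simp: pls_invariant_def unpaired_faces_def)+

lemma unpaired_enqueue_cofaces [simp]:
  "unpaired (enqueue_cofaces L S s) = unpaired s"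
  by (auto simp: enqueue_cofaces_def unpaired_def fun_eq_iff)

lemma unpaired_faces_enqueue_cofaces [simp]:
  "unpaired_faces L (enqueue_cofaces L' S s) = unpaired_faces L s"
  by (simp add: unpaired_faces_def fun_eq_iff)

lemma unpaired_PQ_update [simp]:
  "unpaired (s\<lparr>PQone := A\<rparr>) = unpaired s" "unpaired (s\<lparr>PQzero := A\<rparr>) = unpaired s"
  by (auto simp: unpaired_def fun_eq_iff)

lemma unpaired_faces_PQ_update [simp]:
  "unpaired_faces L (s\<lparr>PQone := A\<rparr>) = unpaired_faces L s"
  "unpaired_faces L (s\<lparr>PQzero := A\<rparr>) = unpaired_faces L s"
  by (simp_all add: unpaired_faces_def fun_eq_iff)

lemma pls_invariant_enqueue_cofaces:
  assumes inv: "pls_invariant L s"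
  shows "pls_invariant L (enqueue_cofaces L S s)"
proof -
  have new: "unpaired s \<gamma> \<and> cell_dim \<gamma> = 2 \<and> (\<exists>\<sigma>. unpaired_faces L s \<gamma> \<subseteq> {\<sigma>})"
    if "\<gamma> \<in> L" and card: "card (unpaired_faces L s \<gamma>) = 1" for \<gamma>
  proof -
    obtain \<sigma> where \<sigma>: "unpaired_faces L s \<gamma> = {\<sigma>}"
      using card by (auto simp: card_1_singleton_iff)
    then show ?thesis
      using unpaired_faces_dim_2[OF inv, of \<sigma> \<gamma>] inv \<open>\<gamma> \<in> L\<close>
      by (auto simp: pls_invariant_def)
  qed
  have "PQone (enqueue_cofaces L S s) = PQone s \<union>
      {\<gamma> \<in> L. (\<exists>\<sigma>\<in>S. codim1_face \<sigma> \<gamma>) \<and> card (unpaired_faces L s \<gamma>) = 1}"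
    "PQzero (enqueue_cofaces L S s) = PQzero s" "pairs (enqueue_cofaces L S s) = pairs s"
    by (simp_all add: enqueue_cofaces_def)
  then show ?thesis
    using inv new unfolding pls_invariant_def unpaired_enqueue_cofaces
      unpaired_faces_enqueue_cofaces by blast
qed

lemma G_minimal_in:
  assumes "finite S" "S \<noteq> {}"
  shows "G_minimal g S \<in> S"
  using arg_min_if_finite(1)[OF assms] by (simp add: G_minimal_def)

text \<open>Classifying the vertex and one edge respects the invariant because faces of an edge are vertices,
  and the lower star contains just one vertex.\<close>

lemma pls_invariant_init:
  assumes x: "vertex_cell x \<in> L" and fin: "finite L"
    and only: "\<And>\<sigma>. \<sigma> \<in> L \<Longrightarrow> cell_dim \<sigma> = 0 \<Longrightarrow> \<sigma> = vertex_cell x"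
  shows "pls_invariant L (pls_init g L x)"
proof (cases "L = {vertex_cell x}")
  case True
  then show ?thesis
    by (auto simp: pls_init_def pls_invariant_def unpaired_def unpaired_faces_def)
next
  case False
  define E where "E = {\<sigma> \<in> L. cell_dim \<sigma> = 1}"
  define \<tau> where "\<tau> = G_minimal g E"
  define s where "s = \<lparr>pairs = {(vertex_cell x, \<tau>)}, critical = {},
           PQzero = E - {\<tau>}, PQone = {}\<rparr>"
  have init: "pls_init g L x = enqueue_cofaces L {\<tau>} s"
    using False by (simp add: pls_init_def Let_def s_def \<tau>_def E_def)
  have unp: "unpaired s \<sigma> \<longleftrightarrow> \<sigma> \<noteq> vertex_cell x \<and> \<sigma> \<noteq> \<tau>" for \<sigma>
    by (auto simp: unpaired_def s_def)
  have low: "unpaired_faces L s \<sigma> = {}" if "cell_dim \<sigma> \<le> 1" for \<sigma>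
    using that only by (auto simp: unpaired_faces_def unp codim1_face_def)
  \<comment> \<open>In the absence of edges \<open>\<tau>\<close> is an arbitrary cell, but then no cell has an unpaired face.\<close>
  have \<tau>: "unpaired_faces L s \<tau> = {}"
  proof (cases "E = {}")
    case True
    have "cell_dim \<sigma> \<noteq> 1" if "\<sigma> \<in> unpaired_faces L s \<tau>" for \<sigma>
      using that True unfolding E_def unpaired_faces_def by blast
    moreover have "cell_dim \<sigma> = 1" if "\<sigma> \<in> unpaired_faces L s \<tau>" for \<sigma>
      using that only[of \<sigma>] codim1_face_dim[of \<sigma> \<tau>] cell_dim_le_2[of \<tau>]
      by (fastforce simp: unpaired_faces_def unp)
    ultimately show ?thesis by blast
  next
    case False
    have "\<tau> \<in> E"
      unfolding \<tau>_def using fin False by (intro G_minimal_in) (auto simp: E_def)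
    then show ?thesis using low by (simp add: E_def)
  qed
  have vx: "unpaired_faces L s (vertex_cell x) = {}"
    by (intro low) (simp add: vertex_cell_def cell_dim_def)
  have zero: "unpaired s \<sigma> \<and> unpaired_faces L s \<sigma> = {}" if "\<sigma> \<in> E - {\<tau>}" for \<sigma>
    using that low[of \<sigma>] by (auto simp: unp E_def vertex_cell_def cell_dim_def)
  have fields: "pairs s = {(vertex_cell x, \<tau>)}" "PQzero s = E - {\<tau>}" "PQone s = {}"
    by (simp_all add: s_def)
  have "pls_invariant L s"
    unfolding pls_invariant_def fields
  proof (intro conjI ballI impI)
    show "unpaired s \<sigma>" if "\<sigma> \<in> L" "unpaired_faces L s \<sigma> \<noteq> {}" for \<sigma>
      using that \<tau> vx by (auto simp: unp)
    show "cell_dim \<sigma> \<noteq> 0" if "\<sigma> \<in> L" "unpaired s \<sigma>" for \<sigma>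
      using that only[of \<sigma>] by (auto simp: unp)
  qed (use x zero in \<open>auto simp: E_def\<close>)
  then show ?thesis
    unfolding init by (rule pls_invariant_enqueue_cofaces)
qed

text \<open>A step on \<open>PQone\<close> either creates a pair, which classifies an edge and a square, or leaves all cells
  as they are and moves a square to \<open>PQzero\<close>. In the first case the square loses its last
  unpaired face together with its own status, and the edge has no unpaired face to begin with, so
  the invariant survives.\<close>

lemma pls_step_one_progress:
  fixes g L s
  assumes inv: "pls_invariant L s" and fin: "finite L" and ne: "PQone s \<noteq> {}"
  defines "s' \<equiv> pls_step_one g L s"
  shows "pls_invariant L s' \<and>
    (unpaired_cells L s' \<subset> unpaired_cells L s \<or>
     unpaired_cells L s' = unpaired_cells L s \<and> PQone s' \<subset> PQone s \<and> PQzero s' \<noteq> {})"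
proof -
  define \<beta> where "\<beta> = G_minimal g (PQone s)"
  have "finite (PQone s)"
    using inv fin by (auto simp: pls_invariant_def intro: finite_subset)
  then have \<beta>: "\<beta> \<in> PQone s"
    using ne unfolding \<beta>_def by (intro G_minimal_in)
  then have \<beta>': "\<beta> \<in> L" "unpaired s \<beta>" "cell_dim \<beta> = 2" "\<exists>\<sigma>. unpaired_faces L s \<beta> \<subseteq> {\<sigma>}"
    using inv by (auto simp: pls_invariant_def)
  show ?thesis
  proof (cases "unpaired_faces L s \<beta> = {}")
    case True
    have s': "s' = s\<lparr>PQone := PQone s - {\<beta>}, PQzero := PQzero s \<union> {\<beta>}\<rparr>"
      using True by (simp add: s'_def pls_step_one_def Let_def flip: \<beta>_def)
    have "pls_invariant L s'"
      using inv \<beta>' True unfolding pls_invariant_def s' by auto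
    moreover have "unpaired_cells L s' = unpaired_cells L s" "PQone s' \<subset> PQone s" "PQzero s' \<noteq> {}"
      using \<beta> by (auto simp: s' unpaired_cells_def)
    ultimately show ?thesis by blast
  next
    case False
    then obtain \<sigma> where \<sigma>: "unpaired_faces L s \<beta> = {\<sigma>}"
      using \<beta>'(4) by blast
    define t where "t = s\<lparr>PQone := PQone s - {\<beta>}, pairs := pairs s \<union> {(\<sigma>, \<beta>)},
        PQzero := PQzero s - {\<sigma>}\<rparr>"
    have s': "s' = enqueue_cofaces L {\<sigma>, \<beta>} t"
      using \<sigma> by (simp add: s'_def pls_step_one_def Let_def t_def flip: \<beta>_def)
    have \<sigma>': "\<sigma> \<in> L" "unpaired s \<sigma>"
      using \<sigma> by (auto simp: unpaired_faces_def)
    have dim\<sigma>: "cell_dim \<sigma> = 1"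
      using unpaired_faces_dim_2(1)[OF inv, of \<sigma> \<beta>] \<sigma> by simp
    have unp: "unpaired t \<rho> \<longleftrightarrow> unpaired s \<rho> \<and> \<rho> \<noteq> \<sigma> \<and> \<rho> \<noteq> \<beta>" for \<rho>
      by (auto simp: unpaired_def t_def)
    have faces: "unpaired_faces L t \<rho> \<subseteq> unpaired_faces L s \<rho>" for \<rho>
      by (auto simp: unpaired_faces_def unp)
    have f\<beta>: "unpaired_faces L t \<beta> = {}"
      using faces[of \<beta>] unfolding \<sigma> by (auto simp: unpaired_faces_def unp)
    have f\<sigma>: "unpaired_faces L t \<sigma> = {}"
      using faces[of \<sigma>] unpaired_faces_dim_2(2)[OF inv, of _ \<sigma>] dim\<sigma> by auto
    have fields: "pairs t = insert (\<sigma>, \<beta>) (pairs s)" "PQzero t = PQzero s - {\<sigma>}"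
      "PQone t = PQone s - {\<beta>}"
      by (simp_all add: t_def)
    have "pls_invariant L t"
      unfolding pls_invariant_def fields
    proof (intro conjI ballI impI)
      fix \<rho> assume "\<rho> \<in> L" "unpaired_faces L t \<rho> \<noteq> {}"
      moreover from this have "unpaired s \<rho>"
        using faces[of \<rho>] inv by (auto simp: pls_invariant_def)
      ultimately show "unpaired t \<rho>"
        using f\<beta> f\<sigma> by (auto simp: unp)
    next
      fix \<rho> assume "\<rho> \<in> PQzero s - {\<sigma>}"
      then have "unpaired s \<rho>" "unpaired_faces L s \<rho> = {}" "\<rho> \<noteq> \<sigma>"
        using inv by (auto simp: pls_invariant_def)
      then show "unpaired t \<rho>" "unpaired_faces L t \<rho> = {}"
        using faces[of \<rho>] \<sigma> by (auto simp: unp)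
    next
      fix \<rho> assume \<rho>: "\<rho> \<in> PQone s - {\<beta>}"
      then have r: "unpaired s \<rho>" "cell_dim \<rho> = 2" "\<exists>\<sigma>. unpaired_faces L s \<rho> \<subseteq> {\<sigma>}"
        using inv by (auto simp: pls_invariant_def)
      then show "unpaired t \<rho>" "cell_dim \<rho> = 2" "\<exists>\<sigma>. unpaired_faces L t \<rho> \<subseteq> {\<sigma>}"
        using \<rho> dim\<sigma> faces[of \<rho>] by (auto simp: unp)
    qed (use inv \<sigma>' in \<open>auto simp: pls_invariant_def unp\<close>)
    then have "pls_invariant L s'"
      unfolding s' by (rule pls_invariant_enqueue_cofaces)
    moreover have "unpaired_cells L s' \<subset> unpaired_cells L s"
      using \<sigma>' by (auto simp: s' unpaired_cells_def unp)
    ultimately show ?thesis by blast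
  qed
qed

lemma pls_step_zero_progress:
  fixes g L s
  assumes inv: "pls_invariant L s" and fin: "finite L" and one: "PQone s = {}" and ne: "PQzero s \<noteq> {}"
  defines "s' \<equiv> pls_step_zero g L s"
  shows "pls_invariant L s' \<and> unpaired_cells L s' \<subset> unpaired_cells L s"
proof -
  define \<delta> where "\<delta> = G_minimal g (PQzero s)"
  define t where "t = s\<lparr>PQzero := PQzero s - {\<delta>}, critical := critical s \<union> {\<delta>}\<rparr>"
  have s': "s' = enqueue_cofaces L {\<delta>} t"
    using ne by (simp add: s'_def pls_step_zero_def Let_def t_def flip: \<delta>_def)
  have "finite (PQzero s)"
    using inv fin by (auto simp: pls_invariant_def intro: finite_subset)
  then have "\<delta> \<in> PQzero s"
    using ne unfolding \<delta>_def by (intro G_minimal_in)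
  then have \<delta>: "\<delta> \<in> L" "unpaired s \<delta>" "unpaired_faces L s \<delta> = {}"
    using inv by (auto simp: pls_invariant_def)
  have unp: "unpaired t \<rho> \<longleftrightarrow> unpaired s \<rho> \<and> \<rho> \<noteq> \<delta>" for \<rho>
    by (auto simp: unpaired_def t_def)
  have faces: "unpaired_faces L t \<rho> \<subseteq> unpaired_faces L s \<rho>" for \<rho>
    by (auto simp: unpaired_faces_def unp)
  have fields: "pairs t = pairs s" "PQzero t = PQzero s - {\<delta>}" "PQone t = {}"
    by (simp_all add: t_def one)
  have "pls_invariant L t"
    unfolding pls_invariant_def fields
  proof (intro conjI ballI impI)
    fix \<rho> assume "\<rho> \<in> L" "unpaired_faces L t \<rho> \<noteq> {}"
    moreover from this have "unpaired_faces L s \<rho> \<noteq> {}"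
      using faces[of \<rho>] by auto
    ultimately show "unpaired t \<rho>"
      using \<delta>(3) inv by (auto simp: unp pls_invariant_def)
  next
    fix \<rho> assume "\<rho> \<in> PQzero s - {\<delta>}"
    then show "unpaired t \<rho>" "unpaired_faces L t \<rho> = {}"
      using inv faces[of \<rho>] by (auto simp: unp pls_invariant_def)
  qed (use inv in \<open>auto simp: pls_invariant_def unp\<close>)
  then have "pls_invariant L s'"
    unfolding s' by (rule pls_invariant_enqueue_cofaces)
  moreover have "unpaired_cells L s' \<subset> unpaired_cells L s"
    using \<delta> by (auto simp: s' unpaired_cells_def unp)
  ultimately show ?thesis by blast
qed

text \<open>If emptying \<open>PQone\<close> classifies no cell, then \<open>PQzero\<close> is nonempty afterwards: either \<open>PQone\<close> was
  empty and \<open>PQzero\<close> was not, or the last step moved a square to \<open>PQzero\<close>. The following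
  step on \<open>PQzero\<close> therefore makes progress in that case.\<close>

lemma pls_inner_loop:
  fixes g L s
  assumes inv: "pls_invariant L s" and fin: "finite L" and ne: "PQone s \<noteq> {} \<or> PQzero s \<noteq> {}"
  defines "s' \<equiv> while (\<lambda>s. PQone s \<noteq> {}) (pls_step_one g L) s"
  shows "pls_invariant L s' \<and> PQone s' = {} \<and>
    (unpaired_cells L s' \<subset> unpaired_cells L s \<or>
     unpaired_cells L s' = unpaired_cells L s \<and> PQzero s' \<noteq> {})"
  unfolding s'_def
proof (rule while_rule[where
      P = "\<lambda>t. pls_invariant L t \<and> (unpaired_cells L t \<subset> unpaired_cells L s \<or>
        unpaired_cells L t = unpaired_cells L s \<and> (PQone t \<noteq> {} \<or> PQzero t \<noteq> {}))"
      and r = "inv_image (finite_psubset <*lex*> finite_psubset) (\<lambda>t. (unpaired_cells L t, PQone t))"])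
  fix t assume t: "pls_invariant L t \<and> (unpaired_cells L t \<subset> unpaired_cells L s \<or>
        unpaired_cells L t = unpaired_cells L s \<and> (PQone t \<noteq> {} \<or> PQzero t \<noteq> {}))"
    and one: "PQone t \<noteq> {}"
  note step = pls_step_one_progress[OF conjunct1[OF t] fin one, of g]
  then show "pls_invariant L (pls_step_one g L t) \<and>
      (unpaired_cells L (pls_step_one g L t) \<subset> unpaired_cells L s \<or>
       unpaired_cells L (pls_step_one g L t) = unpaired_cells L s \<and>
       (PQone (pls_step_one g L t) \<noteq> {} \<or> PQzero (pls_step_one g L t) \<noteq> {}))"
    using t by auto
  have "finite (PQone t)" "finite (unpaired_cells L t)"
    using t fin by (auto simp: pls_invariant_def unpaired_cells_def intro: finite_subset)
  then show "(pls_step_one g L t, t) \<in>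
      inv_image (finite_psubset <*lex*> finite_psubset) (\<lambda>t. (unpaired_cells L t, PQone t))"
    using step by (auto simp: finite_psubset_def)
qed (use inv ne in \<open>auto intro!: wf_inv_image wf_lex_prod wf_finite_psubset\<close>)

text \<open>Every pass of the outer loop classifies a new cell, in its inner loop or by making a cell of \<open>PQzero\<close>
  critical. So the loop ends, and its result satisfies the invariant.\<close>

lemma pairs_process_lower_star:
  fixes g C x
  defines "L \<equiv> lower_star g C x"
  assumes "vertex_cell x \<in> L" and fin: "finite L"
    and "\<And>\<sigma>. \<sigma> \<in> L \<Longrightarrow> cell_dim \<sigma> = 0 \<Longrightarrow> \<sigma> = vertex_cell x"
  shows "fst ` pairs (process_lower_star g C x) \<subseteq> L"
proof -
  define work where "work = (\<lambda>s :: pls_state. PQone s \<noteq> {} \<or> PQzero s \<noteq> {})"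
  define pass where
    "pass = (\<lambda>s. pls_step_zero g L (while (\<lambda>s. PQone s \<noteq> {}) (pls_step_one g L) s))"
  have pass: "pls_invariant L (pass s) \<and> card (unpaired_cells L (pass s)) < card (unpaired_cells L s)"
    if inv: "pls_invariant L s" and "work s" for s
  proof -
    define t where "t = while (\<lambda>s. PQone s \<noteq> {}) (pls_step_one g L) s"
    have t: "pls_invariant L t" "PQone t = {}"
      "unpaired_cells L t \<subset> unpaired_cells L s \<or>
       unpaired_cells L t = unpaired_cells L s \<and> PQzero t \<noteq> {}"
      using pls_inner_loop[OF inv fin, of g] \<open>work s\<close> unfolding t_def work_def by auto
    have finite: "finite (unpaired_cells L s)"
      using fin by (simp add: unpaired_cells_def)
    have *: "pls_invariant L (pass s) \<and> unpaired_cells L (pass s) \<subset> unpaired_cells L s"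
    proof (cases "PQzero t = {}")
      case True
      then have "pass s = t"
        by (simp add: pass_def pls_step_zero_def flip: t_def)
      then show ?thesis using t True by auto
    next
      case False
      then show ?thesis
        using pls_step_zero_progress[OF t(1) fin t(2), of g] t(3)
        by (auto simp: pass_def simp flip: t_def)
    qed
    then show ?thesis
      using finite by (auto intro: psubset_card_mono)
  qed
  have "pls_invariant L (while work pass (pls_init g L x))"
    by (rule while_rule[where P = "pls_invariant L" and r = "measure (\<lambda>s. card (unpaired_cells L s))"])
       (use pass pls_invariant_init[of x L g] assms in auto)
  then show ?thesis
    by (simp add: process_lower_star_def pls_invariant_def work_def pass_def flip: L_def)
qed


section \<open>Comparing pairs vertex by vertex\<close>

lemma fst_pair_in_lower_star:
  assumes inj: "inj_on g X" and X: "complex_vertices C \<subseteq> X" and "finite C"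
    and x: "x \<in> complex_vertices C" and p: "p \<in> pairs (process_lower_star g C x)"
  shows "fst p \<in> lower_star g C x"
proof -
  have "vertex_cell x \<in> lower_star g C x"
    using x by (simp add: lower_star_def complex_vertices_def cell_vertices_vertex_cell)
  moreover have "finite (lower_star g C x)"
    using \<open>finite C\<close> by (simp add: lower_star_def)
  moreover have "\<sigma> = vertex_cell x" if low: "\<sigma> \<in> lower_star g C x" and dim: "cell_dim \<sigma> = 0" for \<sigma>
  proof -
    obtain y where \<sigma>: "\<sigma> = vertex_cell y"
      using dim by (cases \<sigma>; cases "fst \<sigma>"; cases "snd \<sigma>")
        (auto simp: cell_dim_def vertex_cell_def)
    then have "y \<in> complex_vertices C" "g x = g y"
      using low by (auto simp: lower_star_def complex_vertices_def cell_vertices_vertex_cell)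
    then show ?thesis
      using inj X x \<sigma> by (auto dest: inj_onD)
  qed
  ultimately show ?thesis
    using pairs_process_lower_star[of x g C] p by blast
qed

lemma lower_star_vertex_unique:
  assumes "inj_on g X" "x \<in> X" "y \<in> X" "\<sigma> \<in> lower_star g C x" "\<sigma> \<in> lower_star g C' y"
  shows "x = y"
proof (rule inj_onD[OF assms(1)])
  show "g x = g y" using assms(4,5) by (simp add: lower_star_def)
qed (use assms in auto)

theorem theorem3p7:
  fixes a b c d e f :: int
    and g :: "vertex \<Rightarrow> real"
    and K U W :: "cell set"
  assumes "d - a \<ge> 4" and "e < f"
    and "a < b" and "b < c" and "c < d"
    and K: "K = rectangle a d e f"
    and U: "U = rectangle a c e f"
    and W: "W = rectangle b d e f"
    and g_pos: "\<forall>x \<in> complex_vertices K. 0 < g x"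
    and g_bounded: "bdd_above (g ` complex_vertices K)"
    and g_distinct: "inj_on g (complex_vertices K)"
  shows "V_alpha g K =
    (V_alpha g U \<union> V_alpha g W) - (V_alpha g (U \<inter> W) - V_alpha g (nbhd1 K (U \<inter> W)))"
proof -
  define R where "R = (\<lambda>l r. rectangle l r e f)"
  define P where "P = (\<lambda>l r x. pairs (process_lower_star g (R l r) x))"
  have UW: "U \<inter> W = R b c"
    using \<open>a < b\<close> \<open>c < d\<close> by (simp add: U W R_def rectangle_Int max_def min_def)
  have N: "nbhd1 K (U \<inter> W) = R (b - 1) (c + 1)"
    unfolding UW K R_def using \<open>a < b\<close> \<open>b < c\<close> \<open>c < d\<close> by (intro nbhd1_strip) auto
  have V: "p \<in> V_alpha g (R l r) \<longleftrightarrow> (\<exists>i j. l \<le> i \<and> i \<le> r \<and> e \<le> j \<and> j \<le> f \<and> p \<in> P l r (i, j))"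
    for p l r
    by (simp add: V_alpha_def P_def R_def complex_vertices_rectangle Bex_def)
  have inj: "inj_on g (complex_vertices (R l r))" if "a \<le> l" "r \<le> d" for l r
    using g_distinct by (rule inj_on_subset) (use that in \<open>auto simp: K R_def complex_vertices_rectangle\<close>)
  have local: "P l' r' (i, j) = P l r (i, j)"
    if "a \<le> l" "r \<le> d" "l \<le> l'" "r' \<le> r" "l' \<le> i" "i \<le> r'" "e \<le> j" "j \<le> f"
      "l' = l \<or> l' < i" "r' = r \<or> i < r'"
    for l r l' r' i j
  proof -
    have "lower_star g (R l' r') (i, j) = lower_star g (R l r) (i, j)"
      unfolding R_def
      by (rule lower_star_rectangle_eq)
         (use that inj[of l r] in \<open>auto simp: R_def complex_vertices_rectangle\<close>)
    then show ?thesis by (simp add: P_def process_lower_star_def)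
  qed
  have unique: "i = i' \<and> j = j'"
    if p: "p \<in> P l r (i, j)" "p \<in> P l' r' (i', j')"
      and l: "a \<le> l" "l \<le> i" "i \<le> r" "r \<le> d" and j: "e \<le> j" "j \<le> f"
      and l': "a \<le> l'" "l' \<le> i'" "i' \<le> r'" "r' \<le> d" and j': "e \<le> j'" "j' \<le> f"
    for p l r i j l' r' i' j'
  proof -
    have "fst p \<in> lower_star g (R l r) (i, j)"
      by (rule fst_pair_in_lower_star[OF g_distinct])
         (use p l j in \<open>auto simp: P_def K R_def complex_vertices_rectangle finite_rectangle\<close>)
    moreover have "fst p \<in> lower_star g (R l' r') (i', j')"
      by (rule fst_pair_in_lower_star[OF g_distinct])
         (use p l' j' in \<open>auto simp: P_def K R_def complex_vertices_rectangle finite_rectangle\<close>)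
    ultimately have "(i, j) = (i', j')"
      by (intro lower_star_vertex_unique[OF g_distinct])
         (use l j l' j' in \<open>auto simp: K complex_vertices_rectangle\<close>)
    then show ?thesis by simp
  qed
  have strip: "P (b - 1) (c + 1) (i, j) = P a d (i, j)"
    if "b \<le> i" "i \<le> c" "e \<le> j" "j \<le> f" for i j
    by (rule local) (use that assms(3-5) in auto)
  have KR: "K = R a d" and UR: "U = R a c" and WR: "W = R b d"
    by (simp_all add: K U W R_def)
  show ?thesis
    unfolding N unfolding UW unfolding KR UR WR
  proof (intro equalityI subsetI)
    fix p assume "p \<in> V_alpha g (R a d)"
    then obtain i j where ij: "a \<le> i" "i \<le> d" "e \<le> j" "j \<le> f" and p: "p \<in> P a d (i, j)"
      unfolding V by blast
    have "p \<in> V_alpha g (R a c) \<union> V_alpha g (R b d)"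
    proof (cases "i < c")
      case True
      then have "P a c (i, j) = P a d (i, j)"
        by (intro local) (use ij assms(3-5) in auto)
      with True ij p show ?thesis unfolding Un_iff V by fastforce
    next
      case False
      then have "P b d (i, j) = P a d (i, j)"
        by (intro local) (use ij assms(3-5) in auto)
      moreover have "b \<le> i" using False \<open>b < c\<close> by simp
      ultimately show ?thesis using ij p unfolding Un_iff V by blast
    qed
    moreover have "p \<in> V_alpha g (R (b - 1) (c + 1))" if pI: "p \<in> V_alpha g (R b c)"
    proof -
      obtain i' j' where ij': "b \<le> i'" "i' \<le> c" "e \<le> j'" "j' \<le> f" "p \<in> P b c (i', j')"
        using pI unfolding V by blast
      then have "i = i' \<and> j = j'"
        using unique[OF p ij'(5)] ij assms(3-5) by auto
      then have "p \<in> P (b - 1) (c + 1) (i, j)" and "b - 1 \<le> i" "i \<le> c + 1"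
        using strip[of i j] p ij' by auto
      then show ?thesis using ij unfolding V by blast
    qed
    ultimately show "p \<in> V_alpha g (R a c) \<union> V_alpha g (R b d) -
        (V_alpha g (R b c) - V_alpha g (R (b - 1) (c + 1)))" by blast
  next
    fix p assume p: "p \<in> V_alpha g (R a c) \<union> V_alpha g (R b d) -
        (V_alpha g (R b c) - V_alpha g (R (b - 1) (c + 1)))"
    \<comment> \<open>A pair that the strip produces survives the removal only if the enlarged strip produces it
      as well, necessarily at the same vertex, and there the enlarged strip agrees with \<open>K\<close>.\<close>
    have from_strip: "p \<in> V_alpha g (R a d)"
      if ij: "b \<le> i" "i \<le> c" "e \<le> j" "j \<le> f" and pI: "p \<in> P b c (i, j)" for i j
    proof -
      have "p \<in> V_alpha g (R b c)" using ij pI unfolding V by blast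
      with p have "p \<in> V_alpha g (R (b - 1) (c + 1))" by blast
      then obtain i' j' where ij': "b - 1 \<le> i'" "i' \<le> c + 1" "e \<le> j'" "j' \<le> f"
          "p \<in> P (b - 1) (c + 1) (i', j')"
        unfolding V by blast
      then have "i = i' \<and> j = j'"
        using unique[OF pI ij'(5)] ij assms(3-5) by auto
      then have "p \<in> P a d (i, j)" using ij' strip[OF ij] by simp
      moreover have "a \<le> i" "i \<le> d" using ij assms(3-5) by auto
      ultimately show ?thesis using ij unfolding V by blast
    qed
    from p consider "p \<in> V_alpha g (R a c)" | "p \<in> V_alpha g (R b d)" by blast
    then show "p \<in> V_alpha g (R a d)"
    proof cases
      case 1
      then obtain i j where ij: "a \<le> i" "i \<le> c" "e \<le> j" "j \<le> f" and q: "p \<in> P a c (i, j)"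
        unfolding V by blast
      show ?thesis
      proof (cases "i < c")
        case True
        then have "P a c (i, j) = P a d (i, j)"
          by (intro local) (use ij assms(3-5) in auto)
        moreover have "i \<le> d" using True assms(3-5) by simp
        ultimately show ?thesis using ij q unfolding V by blast
      next
        case False
        then have "P b c (i, j) = P a c (i, j)"
          by (intro local) (use ij assms(3-5) in auto)
        then show ?thesis using from_strip[of i j] False ij q assms(3-5) by auto
      qed
    next
      case 2
      then obtain i j where ij: "b \<le> i" "i \<le> d" "e \<le> j" "j \<le> f" and q: "p \<in> P b d (i, j)"
        unfolding V by blast
      show ?thesis
      proof (cases "b < i")
        case True
        then have "P b d (i, j) = P a d (i, j)"
          by (intro local) (use ij assms(3-5) in auto)
        moreover have "a \<le> i" using True assms(3-5) by simp
        ultimately show ?thesis using ij q unfolding V by blast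
      next
        case False
        then have "P b c (i, j) = P b d (i, j)"
          by (intro local) (use ij assms(3-5) in auto)
        then show ?thesis using from_strip[of i j] False ij q assms(3-5) by auto
      qed
    qed
  qed
qed

end
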